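(* Let $N\ge 1$ and let $\omega\in\mathbb{C}$ with $|\omega|=1$, $\omega\ne -1$. Let $$a_n=\frac{\omega+1}{N+1}(n+1)-1,\qquad n=0,1,\dots,N,$$ and let $\Phi_n(z)=\Phi_n(z;N)$, $n=0,\dots,N+1$, be the monic polynomials orthogonal on the unit circle with Verblunsky coefficients $a_n$. Let $P_n(z;N)$, $n=0,\dots,N+2$, be the polynomials obtained from the scaled symmetric Krawtchouk polynomials as described in the context. Then for $n=0,1,\dots,N+1$ $$\Phi_n(z^2;N)=\frac{P_{n+1}(z;N)-A_n\,P_n(z;N)}{z^2-\omega},\qquad A_n=\frac{(\omega+1)(N-n+1)}{N+1}.$$
   Context: The polynomials $\Phi_n$ are defined by $\Phi_0=1$ and $\Phi_{n+1}(z)=z\Phi_n(z)-\overline{a_n}\,\Phi_n^*(z)$, where $\Phi_n^*(z)=z^n\overline{\Phi}_n(1/z)$ and $\overline{\Phi}_n$ is obtained from $\Phi_n$ by conjugating its coefficients. The symmetric Krawtchouk polynomials $K_n(x;N)$ are defined by $K_0=1$, $K_1(x;N)=x$ and $$K_{n+1}(x;N)+v_nK_{n-1}(x;N)=xK_n(x;N),\qquad v_n=\frac{n(N+2-n)}{4}.$$ The scaled polynomials are $\tilde K_n(x;N)=\kappa^nK_n(x/\kappa;N)$, where $$\kappa^2=\frac{4(\omega+1)^2}{\omega(N+1)^2}$$ (the choice of sign of $\kappa$ is immaterial, since $K_n$ has the parity of $n$). Finally $$P_n(z;N)=z^n\,\tilde K_n(z+z^{-1};N);$$ equivalently, $P_0=1$,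 $P_1=z^2+1$ and $$P_{n+1}(z;N)+\frac{(\omega+1)^2\,n(N+2-n)}{\omega(N+1)^2}\,z^2P_{n-1}(z;N)=(z^2+1)P_n(z;N).$$ *)

theory Defs
  imports Complex_Main "HOL-Computational_Algebra.Polynomial"
begin

text \<open>
  The reversed polynomial \<open>p\<^sup>*(z) = z\<^sup>n p\<^sup>-(1/z)\<close>, where \<open>p\<^sup>-\<close> is \<open>p\<close> with conjugated
  coefficients.  The exponent \<open>n\<close> is a parameter and not read off as the degree; the formula is
  meaningful for \<open>degree p \<le> n\<close>, see \<open>poly_rev_star\<close>.
\<close>

definition rev_star :: "nat \<Rightarrow> complex poly \<Rightarrow> complex poly" where
  "rev_star n p = (\<Sum>i\<le>n. monom (coeff (map_poly cnj p) i) (n - i))"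

primrec Phi :: "(nat \<Rightarrow> complex) \<Rightarrow> nat \<Rightarrow> complex poly" where
  "Phi a 0 = 1"
| "Phi a (Suc n) = [:0, 1:] * Phi a n - smult (cnj (a n)) (rev_star n (Phi a n))"

definition verblunsky :: "nat \<Rightarrow> complex \<Rightarrow> nat \<Rightarrow> complex" where
  "verblunsky N \<omega> n = (\<omega> + 1) / (of_nat N + 1) * (of_nat n + 1) - 1"

definition kraw_v :: "nat \<Rightarrow> nat \<Rightarrow> complex" where
  "kraw_v N n = of_nat n * (of_nat N + 2 - of_nat n) / 4"

fun kraw :: "nat \<Rightarrow> nat \<Rightarrow> complex poly" where
  "kraw N 0 = 1"
| "kraw N (Suc 0) = [:0, 1:]"
| "kraw N (Suc (Suc n)) =
     [:0, 1:] * kraw N (Suc n) - smult (kraw_v N (Suc n)) (kraw N n)"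

text \<open>\<open>\<kappa>\<^sup>n K\<^sub>n(x/\<kappa>; N)\<close>\<close>

definition kraw_scaled :: "nat \<Rightarrow> complex \<Rightarrow> nat \<Rightarrow> complex poly" where
  "kraw_scaled N \<kappa> n = smult (\<kappa> ^ n) (pcompose (kraw N n) [:0, 1 / \<kappa>:])"

text \<open>
  \<open>z\<^sup>n q(z + 1/z)\<close> as a polynomial in \<open>z\<close>, for \<open>degree q \<le> n\<close>: the term
  \<open>c\<^sub>i (z + 1/z)\<^sup>i\<close> of \<open>q(z + 1/z)\<close> contributes \<open>c\<^sub>i z\<^bsup>n-i\<^esup> (z\<^sup>2 + 1)\<^sup>i\<close>; see \<open>poly_szego_lift\<close>.
\<close>

definition szego_lift :: "nat \<Rightarrow> complex poly \<Rightarrow> complex poly" where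
  "szego_lift n q = (\<Sum>i\<le>n. smult (coeff q i) (monom 1 (n - i) * [:1, 0, 1:] ^ i))"

definition kraw_P :: "nat \<Rightarrow> complex \<Rightarrow> nat \<Rightarrow> complex poly" where
  "kraw_P N \<kappa> n = szego_lift n (kraw_scaled N \<kappa> n)"

text \<open>The defining formulas at nonzero points.\<close>

lemma poly_eq_sum_le:
  fixes p :: "complex poly"
  assumes "degree p \<le> n"
  shows "poly p x = (\<Sum>i\<le>n. coeff p i * x ^ i)"
proof -
  have "(\<Sum>i\<le>degree p. coeff p i * x ^ i) = (\<Sum>i\<le>n. coeff p i * x ^ i)"
    by (rule sum.mono_neutral_left) (use assms in \<open>auto simp: coeff_eq_0\<close>)
  then show ?thesis by (simp add: poly_altdef)
qed

lemma poly_rev_star: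
  assumes "degree p \<le> n" "z \<noteq> 0"
  shows "poly (rev_star n p) z = z ^ n * poly (map_poly cnj p) (1 / z)"
proof -
  have "degree (map_poly cnj p) \<le> n"
    using assms(1) map_poly_degree_leq[of cnj p] by (meson le_trans)
  then have "z ^ n * poly (map_poly cnj p) (1 / z) =
      (\<Sum>i\<le>n. coeff (map_poly cnj p) i * (z ^ n * (1 / z) ^ i))"
    by (subst poly_eq_sum_le) (simp_all add: sum_distrib_left mult_ac)
  also have "\<dots> = (\<Sum>i\<le>n. coeff (map_poly cnj p) i * z ^ (n - i))"
    using assms(2) by (intro sum.cong refl) (simp add: power_diff power_one_over)
  finally show ?thesis
    by (simp add: rev_star_def poly_sum poly_monom)
qed

lemma poly_szego_lift:
  assumes "degree q \<le> n" "z \<noteq> 0"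
  shows "poly (szego_lift n q) z = z ^ n * poly q (z + 1 / z)"
proof -
  have "z ^ (n - i) * (z\<^sup>2 + 1) ^ i = z ^ n * (z + 1 / z) ^ i" if "i \<le> n" for i
  proof -
    have "z\<^sup>2 + 1 = z * (z + 1 / z)"
      using assms(2) by (simp add: field_simps power2_eq_square)
    then have "z ^ (n - i) * (z\<^sup>2 + 1) ^ i = (z ^ (n - i) * z ^ i) * (z + 1 / z) ^ i"
      by (simp add: power_mult_distrib)
    then show ?thesis using that by (simp flip: power_add)
  qed
  then have "(\<Sum>i\<le>n. coeff q i * (z ^ (n - i) * (z\<^sup>2 + 1) ^ i)) =
      (\<Sum>i\<le>n. coeff q i * (z ^ n * (z + 1 / z) ^ i))"
    by (intro sum.cong) auto
  then show ?thesis
    using assms(1)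
    by (simp add: szego_lift_def poly_sum poly_monom poly_eq_sum_le sum_distrib_left
        power2_eq_square mult_ac add_ac)
qed

lemma degree_kraw: "degree (kraw N n) \<le> n"
  by (induction N n rule: kraw.induct)
    (auto intro!: degree_diff_le order_trans[OF degree_mult_le] order_trans[OF degree_smult_le])

lemma poly_kraw_P:
  assumes "z \<noteq> 0"
  shows "poly (kraw_P N \<kappa> n) z = z ^ n * (\<kappa> ^ n * poly (kraw N n) ((z + 1 / z) / \<kappa>))"
proof -
  have "degree (kraw_scaled N \<kappa> n) \<le> degree (kraw N n) * degree [:0, 1 / \<kappa>:]"
    unfolding kraw_scaled_def
    by (rule order_trans[OF degree_smult_le degree_pcompose_le])
  also have "\<dots> \<le> n * 1"
    by (intro mult_mono degree_kraw) auto
  finally have "degree (kraw_scaled N \<kappa> n) \<le> n" by simp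
  then show ?thesis
    using poly_szego_lift[OF _ assms]
    by (simp add: kraw_P_def kraw_scaled_def poly_pcompose)
qed

end

theory Submission imports Defs begin

text \<open>
  Put \<open>x = z\<^sup>2\<close>. Since \<open>|\<omega>| = 1\<close>, the recurrence coefficients of \<open>P\<^sub>n\<close> are real, so as a
  polynomial in \<open>x\<close> each \<open>P\<^sub>n\<close> is its own reversal, and reversing the claim gives the companion
  formula \<open>(x - \<omega>) \<Phi>\<^sub>n\<^sup>* = A\<^sub>n x P\<^sub>n - \<omega> P\<^sub>n\<^sub>+\<^sub>1\<close>. Both formulas follow together by induction from
  the coupled recurrences \<open>\<Phi>\<^sub>n\<^sub>+\<^sub>1 = x \<Phi>\<^sub>n - cnj a\<^sub>n \<Phi>\<^sub>n\<^sup>*\<close>, \<open>\<Phi>\<^sub>n\<^sub>+\<^sub>1\<^sup>* = \<Phi>\<^sub>n\<^sup>* - a\<^sub>n x \<Phi>\<^sub>n\<close>, using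
  \<open>A\<^sub>n = \<omega> - a\<^sub>n\<^sub>-\<^sub>1\<close> and the factorisation of the coefficient of \<open>x P\<^sub>n\<close> in the recurrence of \<open>P\<close>
  as \<open>A\<^sub>n (1 + cnj a\<^sub>n)\<close>.
\<close>

lemma coeff_rev_star:
  "coeff (rev_star n p) k = (if k \<le> n then cnj (coeff p (n - k)) else 0)"
proof -
  have "coeff (rev_star n p) k = (\<Sum>i\<le>n. if i = n - k \<and> k \<le> n then cnj (coeff p i) else 0)"
    unfolding rev_star_def coeff_sum
    by (intro sum.cong) (auto simp: coeff_map_poly)
  then show ?thesis by (cases "k \<le> n") (simp_all add: sum.delta)
qed

lemma degree_rev_star: "degree (rev_star n p) \<le> n"
  by (rule degree_le) (simp add: coeff_rev_star)

lemma degree_Phi: "degree (Phi a n) \<le> n"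
proof (induction n)
  case (Suc n)
  have "degree ([:0, 1:] * Phi a n) \<le> Suc n"
    using degree_mult_le[of "[:0, 1:]" "Phi a n"] Suc by simp
  moreover have "degree (smult (cnj (a n)) (rev_star n (Phi a n))) \<le> Suc n"
    by (meson degree_rev_star degree_smult_le le_SucI le_trans)
  ultimately show ?case by (simp add: degree_diff_le)
qed simp

text \<open>Reversal with exponent \<open>Suc n\<close> conjugates scalars, takes
  \<open>[:0, 1:] * p\<close> to \<open>rev_star n p\<close> and, if
  \<open>degree p \<le> n\<close>, takes \<open>rev_star n p\<close> back to
  \<open>[:0, 1:] * p\<close>.\<close>

lemma rev_star_Phi_Suc:
  "rev_star (Suc n) (Phi a (Suc n)) =
     rev_star n (Phi a n) - smult (a n) ([:0, 1:] * Phi a n)"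
proof (rule poly_eqI)
  fix k
  have "coeff (Phi a n) m = 0" if "m > n" for m
    using that degree_Phi[of a n] by (intro coeff_eq_0) simp
  then show "coeff (rev_star (Suc n) (Phi a (Suc n))) k =
      coeff (rev_star n (Phi a n) - smult (a n) ([:0, 1:] * Phi a n)) k"
    by (auto simp: coeff_rev_star coeff_pCons le_Suc_eq Suc_diff_le split: nat.split)
qed

text \<open>Multiplying the difference by the variable makes it vanish at 0 too. This is needed
  because \<open>poly_kraw_P\<close> evaluates \<open>kraw_P\<close> only away from 0.\<close>

lemma poly_eqI_nonzero:
  fixes p q :: "'a :: {idom, ring_char_0} poly"
  assumes "\<And>x. x \<noteq> 0 \<Longrightarrow> poly p x = poly q x"
  shows "p = q"
proof -
  have "poly ([:0, 1:] * (p - q)) x = 0" for x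
    using assms by (cases "x = 0") auto
  then have "[:0, 1:] * (p - q) = 0"
    using poly_all_0_iff_0 by blast
  then show ?thesis
    by (simp only: mult_eq_0_iff) auto
qed

text \<open>The recurrence of \<open>kraw\<close> at \<open>(z + 1 / z) / \<kappa>\<close>,
  multiplied by the power \<open>Suc (Suc n)\<close> of \<open>\<kappa> * z\<close>.\<close>

lemma kraw_P_Suc_Suc:
  assumes "\<kappa> \<noteq> 0"
  shows "kraw_P N \<kappa> (Suc (Suc n)) = [:1, 0, 1:] * kraw_P N \<kappa> (Suc n)
    - smult (\<kappa>\<^sup>2 * kraw_v N (Suc n)) ([:0, 0, 1:] * kraw_P N \<kappa> n)"
proof (rule poly_eqI_nonzero)
  fix z :: complex
  assume z: "z \<noteq> 0"
  show "poly (kraw_P N \<kappa> (Suc (Suc n))) z = poly ([:1, 0, 1:] * kraw_P N \<kappa> (Suc n)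
      - smult (\<kappa>\<^sup>2 * kraw_v N (Suc n)) ([:0, 0, 1:] * kraw_P N \<kappa> n)) z"
    using z assms
    by (simp add: poly_kraw_P field_simps power2_eq_square del: of_nat_Suc)
qed

lemma kraw_P_0: "kraw_P N \<kappa> 0 = 1"
  by (rule poly_eqI_nonzero) (simp add: poly_kraw_P)

lemma kraw_P_1:
  assumes "\<kappa> \<noteq> 0"
  shows "kraw_P N \<kappa> (Suc 0) = [:1, 0, 1:]"
  using assms by (intro poly_eqI_nonzero) (simp add: poly_kraw_P field_simps)

lemma Phi_verblunsky_kraw_P:
  fixes N n :: nat and \<omega> \<kappa> z :: complex
  defines "A \<equiv> \<lambda>n. (\<omega> + 1) * (of_nat N - of_nat n + 1) / (of_nat N + 1)"
  assumes "norm \<omega> = 1" and "\<omega> \<noteq> -1"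
    and kappa: "\<kappa>\<^sup>2 = 4 * (\<omega> + 1)\<^sup>2 / (\<omega> * (of_nat N + 1)\<^sup>2)"
  shows "(z\<^sup>2 - \<omega>) * poly (Phi (verblunsky N \<omega>) n) (z\<^sup>2) =
      poly (kraw_P N \<kappa> (Suc n)) z - A n * poly (kraw_P N \<kappa> n) z"
    and "(z\<^sup>2 - \<omega>) * poly (rev_star n (Phi (verblunsky N \<omega>) n)) (z\<^sup>2) =
      A n * z\<^sup>2 * poly (kraw_P N \<kappa> n) z - \<omega> * poly (kraw_P N \<kappa> (Suc n)) z"
proof (induction n)
  define M where "M = (of_nat N + 1 :: complex)"
  have "M = of_nat (Suc N)" by (simp add: M_def)
  then have M: "M \<noteq> 0" by (simp only: of_nat_eq_0_iff)
  have w: "\<omega> \<noteq> 0" using assms(2) by auto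
  have s: "\<omega> + 1 \<noteq> 0" using assms(3) by (simp add: add_eq_0_iff2)
  \<comment> \<open>On the unit circle conjugation is inversion, so \<open>cnj (?a n)\<close>
    becomes rational in \<open>\<omega>\<close>.\<close>
  have cnj_w: "cnj \<omega> = 1 / \<omega>"
    using complex_norm_square[of \<omega>] assms(2) w by (simp add: field_simps)
  have k: "\<kappa> \<noteq> 0"
    using kappa w s M by (auto simp: M_def)
  let ?a = "verblunsky N \<omega>"
  have A_0: "A 0 = \<omega> + 1"
    using M by (simp add: A_def flip: M_def)
  have A_Suc: "A (Suc n) = \<omega> - ?a n" for n
  using M by (simp add: A_def verblunsky_def M_def field_simps)
  have one_cnj_a: "1 + cnj (?a n) = (\<omega> + 1) * (of_nat n + 1) / (\<omega> * M)" for n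
  proof -
    have "1 + cnj (?a n) = (1 / \<omega> + 1) / M * (of_nat n + 1)"
      by (simp add: verblunsky_def cnj_w M_def)
    also have "1 / \<omega> + 1 = (\<omega> + 1) / \<omega>"
      using w by (simp add: add_divide_distrib)
    finally show ?thesis by simp
  qed
  have cnj_a: "\<omega> * cnj (?a n) = 1 + ?a n - \<omega>" for n
  proof -
    have "\<omega> * (1 + cnj (?a n)) = 1 + ?a n"
      unfolding one_cnj_a using w by (simp add: verblunsky_def M_def)
    then show ?thesis by (simp add: algebra_simps)
  qed
  have d: "\<kappa>\<^sup>2 * kraw_v N (Suc n) = A n * (1 + cnj (?a n))" for n
  proof -
    \<comment> \<open>The index shift turns \<open>N + 2 - Suc n\<close> into \<open>M - n\<close>;
      the factors 4 cancel.\<close>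
    have "\<kappa>\<^sup>2 * kraw_v N (Suc n) = (\<omega> + 1)\<^sup>2 * (of_nat n + 1) * (M - of_nat n) / (\<omega> * M\<^sup>2)"
      using M w unfolding kappa kraw_v_def by (simp add: field_simps M_def)
    also have "\<dots> = ((\<omega> + 1) * (M - of_nat n) / M) * ((\<omega> + 1) * (of_nat n + 1) / (\<omega> * M))"
      by (simp add: power2_eq_square mult_ac)
    also have "(\<omega> + 1) * (M - of_nat n) / M = A n"
      by (simp add: A_def M_def algebra_simps)
    finally show ?thesis by (simp only: one_cnj_a)
  qed
  have rec: "poly (kraw_P N \<kappa> (Suc (Suc n))) z = (z\<^sup>2 + 1) * poly (kraw_P N \<kappa> (Suc n)) z
      - A n * (1 + cnj (?a n)) * z\<^sup>2 * poly (kraw_P N \<kappa> n) z" for n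
    unfolding kraw_P_Suc_Suc[OF k] d by (simp add: algebra_simps power2_eq_square)
  {
    case 0
    case 1
    show ?case
      using k by (simp add: kraw_P_0 kraw_P_1 A_0 power2_eq_square)
  next
    case 0
    case 2
    have "rev_star 0 1 = (1 :: complex poly)"
      by (rule poly_eqI) (auto simp: coeff_rev_star)
    then show ?case
      using k by (simp add: kraw_P_0 kraw_P_1 A_0 power2_eq_square algebra_simps)
  next
    case (Suc n)
    case 1
    have "(z\<^sup>2 - \<omega>) * poly (Phi ?a (Suc n)) (z\<^sup>2) =
        z\<^sup>2 * ((z\<^sup>2 - \<omega>) * poly (Phi ?a n) (z\<^sup>2))
        - cnj (?a n) * ((z\<^sup>2 - \<omega>) * poly (rev_star n (Phi ?a n)) (z\<^sup>2))"
      by (simp add: algebra_simps)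
    \<comment> \<open>The coefficients of \<open>kraw_P N \<kappa> n\<close> agree outright, those
      of \<open>kraw_P N \<kappa> (Suc n)\<close> by \<open>cnj_a\<close>.\<close>
    then show ?case
      unfolding Suc rec A_Suc using cnj_a[of n] by algebra
  next
    case (Suc n)
    case 2
    have "(z\<^sup>2 - \<omega>) * poly (rev_star (Suc n) (Phi ?a (Suc n))) (z\<^sup>2) =
        (z\<^sup>2 - \<omega>) * poly (rev_star n (Phi ?a n)) (z\<^sup>2)
        - ?a n * z\<^sup>2 * ((z\<^sup>2 - \<omega>) * poly (Phi ?a n) (z\<^sup>2))"
      by (simp add: rev_star_Phi_Suc algebra_simps del: Phi.simps)
    \<comment> \<open>Here the roles are exchanged: the coefficients of
      \<open>kraw_P N \<kappa> n\<close> need \<open>cnj_a\<close>, in the form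
      \<open>\<omega> * (1 + cnj (?a n)) = 1 + ?a n\<close>.\<close>
    then show ?case
      unfolding Suc rec A_Suc using cnj_a[of n] by algebra
  }
qed

theorem proposition6p1:
  fixes N n :: nat and \<omega> \<kappa> z :: complex
  assumes "N \<ge> 1"
    and "norm \<omega> = 1" and "\<omega> \<noteq> -1"
    and "\<kappa>\<^sup>2 = 4 * (\<omega> + 1)\<^sup>2 / (\<omega> * (of_nat N + 1)\<^sup>2)"
    and "n \<le> N + 1"
    and "z\<^sup>2 \<noteq> \<omega>"
  shows "poly (Phi (verblunsky N \<omega>) n) (z\<^sup>2) =
    (poly (kraw_P N \<kappa> (n + 1)) z
      - (\<omega> + 1) * (of_nat N - of_nat n + 1) / (of_nat N + 1) * poly (kraw_P N \<kappa> n) z)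
    / (z\<^sup>2 - \<omega>)"
  using Phi_verblunsky_kraw_P(1)[OF assms(2-4), of z n] assms(6)
  by (simp add: eq_divide_eq mult.commute)

end
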